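(* Let $\gamma\colon C\to D$ and $\delta\colon D\to E$ be functors between categories, with $\gamma$ being frank. Let $a,b\in \mathrm{ob}(C)$. If $\gamma$ fulfills (P) at $a$ and $\delta$ fulfills (P) at $\gamma(a),\gamma(b)$, then $\delta\circ\gamma$ fulfills (P) at $a,b$.
   Context: For a category $C$, $\mathrm{ob}(C)$ is the class of objects and $\hom(a,b)$ is the class of morphisms of $C$ from $a$ to $b$; composition is written $g\cdot f$ (for $f\in\hom(a,b)$, $g\in\hom(b,c)$, $g\cdot f\in\hom(a,c)$). $\mathbb N$ includes $0$. For $r\in\mathbb N$, an $r$-coloring of a set $X$ is a function on $X$ with at most $r$ values. Condition (P). Let $\delta$ be a functor defined on a category $C$ and let $a,b\in \mathrm{ob}(C)$. The functor $\delta$ fulfills (P) at $a,b$ if for each $r\in\mathbb N$ there exists $c\in \mathrm{ob}(C)$ such that for each $r$-coloring $\chi$ of $\hom(a,c)$ there exists $g\in\hom(b,c)$ such that for all $f_1,f_2\in\hom(a,b)$: $\delta(f_1)=\delta(f_2)$ implies $\chi(g\cdot f_1)=\chi(g\cdot f_2)$. The functor $\delta$ fulfills (P) at $a\in\mathrm{ob}(C)$ if it fulfills (P) at $a,b$ for all $b\in \mathrm{ob}(C)$. Frank functors. A functor $\delta\colon C\to D$ is frank if for all $a\in\mathrm{ob}(C)$ and $b'\in\mathrm{ob}(D)$ there exists $b\in\mathrm{ob}(C)$ with $\delta(b)=b'$ (equality of objects) and $\delta(\hom(a,b))=\hom(\delta(a),\delta(b))$. *)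

theory Defs
  imports Main
begin

record ('o, 'm) category =
  Obj :: "'o set"
  Arr :: "'m set"
  Dom :: "'m \<Rightarrow> 'o"
  Cod :: "'m \<Rightarrow> 'o"
  Ident :: "'o \<Rightarrow> 'm"
  Comp :: "'m \<Rightarrow> 'm \<Rightarrow> 'm"

definition hom :: "('o, 'm) category \<Rightarrow> 'o \<Rightarrow> 'o \<Rightarrow> 'm set" where
  "hom C a b = {f \<in> Arr C. Dom C f = a \<and> Cod C f = b}"

text \<open>\<^term>\<open>Comp C g f\<close> is $g \cdot f$: first \<^term>\<open>f\<close>, then \<^term>\<open>g\<close>.
  The operations are unconstrained outside objects and composable pairs of morphisms.\<close>

locale category =
  fixes C :: "('o, 'm) category"
  assumes Dom_in_Obj: "f \<in> Arr C \<Longrightarrow> Dom C f \<in> Obj C"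
    and Cod_in_Obj: "f \<in> Arr C \<Longrightarrow> Cod C f \<in> Obj C"
    and Id_in_hom: "a \<in> Obj C \<Longrightarrow> Ident C a \<in> hom C a a"
    and Comp_in_hom: "\<lbrakk>f \<in> hom C a b; g \<in> hom C b c\<rbrakk> \<Longrightarrow> Comp C g f \<in> hom C a c"
    and Comp_Id_right: "f \<in> hom C a b \<Longrightarrow> Comp C f (Ident C a) = f"
    and Comp_Id_left: "f \<in> hom C a b \<Longrightarrow> Comp C (Ident C b) f = f"
    and Comp_assoc: "\<lbrakk>f \<in> hom C a b; g \<in> hom C b c; h \<in> hom C c d\<rbrakk>
      \<Longrightarrow> Comp C h (Comp C g f) = Comp C (Comp C h g) f"

record ('o, 'm, 'p, 'n) funct =
  obj_map :: "'o \<Rightarrow> 'p"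
  arr_map :: "'m \<Rightarrow> 'n"

locale is_functor = source: category C + target: category D
  for C :: "('o, 'm) category" and D :: "('p, 'n) category" +
  fixes F :: "('o, 'm, 'p, 'n) funct"
  assumes obj_map_in_Obj: "a \<in> Obj C \<Longrightarrow> obj_map F a \<in> Obj D"
    and arr_map_in_hom:
      "f \<in> hom C a b \<Longrightarrow> arr_map F f \<in> hom D (obj_map F a) (obj_map F b)"
    and arr_map_Id: "a \<in> Obj C \<Longrightarrow> arr_map F (Ident C a) = Ident D (obj_map F a)"
    and arr_map_Comp: "\<lbrakk>f \<in> hom C a b; g \<in> hom C b c\<rbrakk>
      \<Longrightarrow> arr_map F (Comp C g f) = Comp D (arr_map F g) (arr_map F f)"

definition funct_comp ::
  "('p, 'n, 'q, 'k) funct \<Rightarrow> ('o, 'm, 'p, 'n) funct \<Rightarrow> ('o, 'm, 'q, 'k) funct"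
  (infixl "\<circ>\<^sub>F" 55) where
  "G \<circ>\<^sub>F F = \<lparr>obj_map = obj_map G \<circ> obj_map F, arr_map = arr_map G \<circ> arr_map F\<rparr>"

definition frank ::
  "('o, 'm) category \<Rightarrow> ('p, 'n) category \<Rightarrow> ('o, 'm, 'p, 'n) funct \<Rightarrow> bool" where
  "frank C D F \<longleftrightarrow> is_functor C D F \<and>
    (\<forall>a\<in>Obj C. \<forall>b'\<in>Obj D. \<exists>b\<in>Obj C.
      obj_map F b = b' \<and> arr_map F ` hom C a b = hom D (obj_map F a) (obj_map F b))"

definition coloring :: "nat \<Rightarrow> 'x set \<Rightarrow> ('x \<Rightarrow> 'c) \<Rightarrow> bool" where
  "coloring r X \<chi> \<longleftrightarrow> finite (\<chi> ` X) \<and> card (\<chi> ` X) \<le> r"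

text \<open>Colors are natural numbers in the next definition because a bound variable needs a
  fixed type. This is no restriction, as \<open>fulfills_P_at2_any_colors\<close> below shows.\<close>

definition fulfills_P_at2 ::
  "('o, 'm) category \<Rightarrow> ('o, 'm, 'p, 'n) funct \<Rightarrow> 'o \<Rightarrow> 'o \<Rightarrow> bool" where
  "fulfills_P_at2 C F a b \<longleftrightarrow>
    (\<forall>r::nat. \<exists>c\<in>Obj C. \<forall>\<chi> :: 'm \<Rightarrow> nat. coloring r (hom C a c) \<chi> \<longrightarrow>
      (\<exists>g\<in>hom C b c. \<forall>f1\<in>hom C a b. \<forall>f2\<in>hom C a b.
        arr_map F f1 = arr_map F f2 \<longrightarrow> \<chi> (Comp C g f1) = \<chi> (Comp C g f2)))"

definition fulfills_P_at ::
  "('o, 'm) category \<Rightarrow> ('o, 'm, 'p, 'n) funct \<Rightarrow> 'o \<Rightarrow> bool" where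
  "fulfills_P_at C F a \<longleftrightarrow> (\<forall>b\<in>Obj C. fulfills_P_at2 C F a b)"

lemma fulfills_P_at2_any_colors:
  assumes "category C" and P: "fulfills_P_at2 C F a b"
  shows "\<exists>c\<in>Obj C. \<forall>\<chi> :: 'm \<Rightarrow> 'c. coloring r (hom C a c) \<chi> \<longrightarrow>
    (\<exists>g\<in>hom C b c. \<forall>f1\<in>hom C a b. \<forall>f2\<in>hom C a b.
      arr_map F f1 = arr_map F f2 \<longrightarrow> \<chi> (Comp C g f1) = \<chi> (Comp C g f2))"
proof -
  interpret category C by fact
  obtain c where c: "c \<in> Obj C" and *: "\<And>\<chi> :: 'm \<Rightarrow> nat. coloring r (hom C a c) \<chi> \<Longrightarrow>
      \<exists>g\<in>hom C b c. \<forall>f1\<in>hom C a b. \<forall>f2\<in>hom C a b.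
        arr_map F f1 = arr_map F f2 \<longrightarrow> \<chi> (Comp C g f1) = \<chi> (Comp C g f2)"
    using P unfolding fulfills_P_at2_def by blast
  show ?thesis
  proof (intro bexI[OF _ c] allI impI)
    fix \<chi> :: "'m \<Rightarrow> 'c"
    assume col: "coloring r (hom C a c) \<chi>"
    then obtain h :: "'c \<Rightarrow> nat" where inj: "inj_on h (\<chi> ` hom C a c)"
      unfolding coloring_def using finite_imp_inj_to_nat_seg by metis
    have "coloring r (hom C a c) (h \<circ> \<chi>)"
      using col inj unfolding coloring_def image_comp[symmetric] by (simp add: card_image)
    from *[OF this] obtain g where g: "g \<in> hom C b c" and
      eq: "\<And>f1 f2. \<lbrakk>f1 \<in> hom C a b; f2 \<in> hom C a b; arr_map F f1 = arr_map F f2\<rbrakk> \<Longrightarrow>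
        h (\<chi> (Comp C g f1)) = h (\<chi> (Comp C g f2))"
      by auto
    show "\<exists>g\<in>hom C b c. \<forall>f1\<in>hom C a b. \<forall>f2\<in>hom C a b.
      arr_map F f1 = arr_map F f2 \<longrightarrow> \<chi> (Comp C g f1) = \<chi> (Comp C g f2)"
      by (intro bexI[OF _ g] ballI impI inj_onD[OF inj] eq imageI Comp_in_hom[OF _ g])
  qed
qed

end

theory Submission
  imports Defs
begin

text \<open>A coloring of \<open>hom(a, e)\<close> is pulled back along \<open>g\<^sub>0 \<in> hom(d, e)\<close>, which is chosen by (P) for
  \<open>\<gamma>\<close>. On \<open>hom(a, d)\<close> the pullback depends only on images under \<open>\<gamma>\<close>, so it induces a coloring of
  \<open>hom(\<gamma>(a), \<gamma>(d))\<close>, to which (P) for \<open>\<delta>\<close> applies. Frankness, used at \<open>b\<close>, supplies the object \<open>d\<close>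
  over a given object of \<open>D\<close> and lifts the resulting morphism \<open>g' \<in> hom(\<gamma>(b), \<gamma>(d))\<close> to \<open>hom(b, d)\<close>.\<close>

lemma coloring_subset:
  assumes "finite S" "card S \<le> r" "\<chi> ` X \<subseteq> S"
  shows "coloring r X \<chi>"
  unfolding coloring_def
  using assms(2) card_mono[OF assms(1,3)] finite_subset[OF assms(3,1)] by simp

lemma coloring_factor:
  fixes \<chi> :: "'x \<Rightarrow> 'c" and p :: "'x \<Rightarrow> 'y"
  assumes "coloring r X \<chi>" and "r > 0"
    and respects: "\<And>x1 x2. \<lbrakk>x1 \<in> X; x2 \<in> X; p x1 = p x2\<rbrakk> \<Longrightarrow> \<chi> x1 = \<chi> x2"
  shows "\<exists>\<chi>' :: 'y \<Rightarrow> 'c. coloring r Y \<chi>' \<and> (\<forall>x\<in>X. \<chi>' (p x) = \<chi> x)"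
proof -
  \<comment> \<open>For empty \<open>X\<close> there is no color to reuse, so an arbitrary one is
    supplied; it fits the bound because \<open>r > 0\<close>.\<close>
  define S where "S = (if X = {} then {undefined} else \<chi> ` X)"
  have S: "finite S" "card S \<le> r" "\<chi> ` X \<subseteq> S"
    using assms(1,2) by (auto simp: S_def coloring_def)
  obtain s where s: "s \<in> S"
    by (cases "X = {}") (auto simp: S_def)
  define \<chi>' where "\<chi>' y = (if y \<in> p ` X then \<chi> (inv_into X p y) else s)" for y
  have "\<chi>' y \<in> S" for y
    using S(3) s inv_into_into[of y p X] by (auto simp: \<chi>'_def)
  then have "coloring r Y \<chi>'"
    by (intro coloring_subset[OF S(1,2)]) auto
  moreover have "\<chi>' (p x) = \<chi> x" if "x \<in> X" for x
    using that respects[OF inv_into_into[of "p x" p X] that f_inv_into_f[of "p x" p X]]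
    by (simp add: \<chi>'_def)
  ultimately show ?thesis by blast
qed

theorem theorem6:
  fixes C :: "('o, 'm) category"
    and D :: "('p, 'n) category"
    and E :: "('q, 'k) category"
    and \<gamma> :: "('o, 'm, 'p, 'n) funct"
    and \<delta> :: "('p, 'n, 'q, 'k) funct"
    and a b :: 'o
  assumes "is_functor C D \<gamma>"
    and "is_functor D E \<delta>"
    and "frank C D \<gamma>"
    and "a \<in> Obj C"
    and "b \<in> Obj C"
    and "fulfills_P_at C \<gamma> a"
    and "fulfills_P_at2 D \<delta> (obj_map \<gamma> a) (obj_map \<gamma> b)"
  shows "fulfills_P_at2 C (\<delta> \<circ>\<^sub>F \<gamma>) a b"
  unfolding fulfills_P_at2_def
proof
  fix r :: nat
  interpret \<gamma>: is_functor C D \<gamma> by fact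
  note Comp_in_hom = \<gamma>.source.Comp_in_hom
  show "\<exists>c\<in>Obj C. \<forall>\<chi> :: 'm \<Rightarrow> nat. coloring r (hom C a c) \<chi> \<longrightarrow>
    (\<exists>g\<in>hom C b c. \<forall>f1\<in>hom C a b. \<forall>f2\<in>hom C a b.
      arr_map (\<delta> \<circ>\<^sub>F \<gamma>) f1 = arr_map (\<delta> \<circ>\<^sub>F \<gamma>) f2 \<longrightarrow> \<chi> (Comp C g f1) = \<chi> (Comp C g f2))"
  proof (cases "r = 0")
    case True
    \<comment> \<open>The set \<open>hom(a, a)\<close> contains the identity and so has no \<open>0\<close>-coloring.\<close>
    then have "\<not> coloring r (hom C a a) \<chi>" for \<chi> :: "'m \<Rightarrow> nat"
      using \<gamma>.source.Id_in_hom[OF \<open>a \<in> Obj C\<close>] by (auto simp: coloring_def card_gt_0_iff)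
    then show ?thesis
      using \<open>a \<in> Obj C\<close> by blast
  next
    case False
    \<comment> \<open>The objects \<open>c'\<close>, \<open>d\<close> and \<open>e\<close> depend on
      \<open>r\<close> alone and are fixed before any coloring is given. (P) for
      \<open>\<gamma>\<close> is applied at \<open>a\<close>, \<open>d\<close>, where
      \<open>d\<close> is known only after \<open>c'\<close>.\<close>
    obtain c' where c': "c' \<in> Obj D" and P_\<delta>:
      "\<And>\<chi> :: 'n \<Rightarrow> nat. coloring r (hom D (obj_map \<gamma> a) c') \<chi> \<Longrightarrow>
        \<exists>g\<in>hom D (obj_map \<gamma> b) c'. \<forall>f1\<in>hom D (obj_map \<gamma> a) (obj_map \<gamma> b).
          \<forall>f2\<in>hom D (obj_map \<gamma> a) (obj_map \<gamma> b). arr_map \<delta> f1 = arr_map \<delta> f2 \<longrightarrow>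
            \<chi> (Comp D g f1) = \<chi> (Comp D g f2)"
      using assms(7) unfolding fulfills_P_at2_def by metis
    obtain d where d: "d \<in> Obj C" "arr_map \<gamma> ` hom C b d = hom D (obj_map \<gamma> b) c'"
      using \<open>frank C D \<gamma>\<close> \<open>b \<in> Obj C\<close> c' unfolding frank_def by metis
    have "fulfills_P_at2 C \<gamma> a d"
      using assms(6) d(1) by (simp add: fulfills_P_at_def)
    then obtain e where e: "e \<in> Obj C" and P_\<gamma>:
      "\<And>\<chi> :: 'm \<Rightarrow> nat. coloring r (hom C a e) \<chi> \<Longrightarrow>
        \<exists>g\<in>hom C d e. \<forall>f1\<in>hom C a d. \<forall>f2\<in>hom C a d.
          arr_map \<gamma> f1 = arr_map \<gamma> f2 \<longrightarrow> \<chi> (Comp C g f1) = \<chi> (Comp C g f2)"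
      unfolding fulfills_P_at2_def by metis
    show ?thesis
    proof (intro bexI[OF _ e] allI impI)
      fix \<chi> :: "'m \<Rightarrow> nat"
      assume \<chi>: "coloring r (hom C a e) \<chi>"
      obtain g0 where g0: "g0 \<in> hom C d e" and g0_eq:
        "\<And>f1 f2. \<lbrakk>f1 \<in> hom C a d; f2 \<in> hom C a d; arr_map \<gamma> f1 = arr_map \<gamma> f2\<rbrakk> \<Longrightarrow>
          \<chi> (Comp C g0 f1) = \<chi> (Comp C g0 f2)"
        using P_\<gamma>[OF \<chi>] by blast
      \<comment> \<open>Composition with \<open>g0\<close> maps \<open>hom C a d\<close> into
        \<open>hom C a e\<close>, so no new colors arise.\<close>
      have "coloring r (hom C a d) (\<lambda>f. \<chi> (Comp C g0 f))"
        using \<chi> Comp_in_hom[OF _ g0]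
        by (intro coloring_subset[of "\<chi> ` hom C a e"]) (auto simp: coloring_def)
      \<comment> \<open>Frankness was used at \<open>b\<close>, so the image of
        \<open>hom C a d\<close> under \<open>\<gamma>\<close> may miss part of
        \<open>hom D (obj_map \<gamma> a) c'\<close>; \<open>\<chi>'\<close> must be extended to all
        of it.\<close>
      then have "\<exists>\<chi>' :: 'n \<Rightarrow> nat. coloring r (hom D (obj_map \<gamma> a) c') \<chi>' \<and>
          (\<forall>f\<in>hom C a d. \<chi>' (arr_map \<gamma> f) = \<chi> (Comp C g0 f))"
        by (rule coloring_factor) (use False in simp, rule g0_eq)
      then obtain \<chi>' :: "'n \<Rightarrow> nat" where \<chi>': "coloring r (hom D (obj_map \<gamma> a) c') \<chi>'"
        and \<chi>'_eq: "\<And>f. f \<in> hom C a d \<Longrightarrow> \<chi>' (arr_map \<gamma> f) = \<chi> (Comp C g0 f)"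
        by blast
      obtain g' where g': "g' \<in> hom D (obj_map \<gamma> b) c'" and g'_eq:
        "\<And>f1 f2. \<lbrakk>f1 \<in> hom D (obj_map \<gamma> a) (obj_map \<gamma> b); f2 \<in> hom D (obj_map \<gamma> a) (obj_map \<gamma> b);
          arr_map \<delta> f1 = arr_map \<delta> f2\<rbrakk> \<Longrightarrow> \<chi>' (Comp D g' f1) = \<chi>' (Comp D g' f2)"
        using P_\<delta>[OF \<chi>'] by blast
      obtain h where h: "h \<in> hom C b d" "arr_map \<gamma> h = g'"
        using g'[folded d(2)] by blast
      \<comment> \<open>Regroup as \<open>g0\<close> after the composite of \<open>h\<close> and
        \<open>f\<close>, which \<open>\<gamma>\<close> sends to
        \<open>Comp D g' (arr_map \<gamma> f)\<close>.\<close>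
      have \<chi>_lift: "\<chi> (Comp C (Comp C g0 h) f) = \<chi>' (Comp D g' (arr_map \<gamma> f))"
        if f: "f \<in> hom C a b" for f
        using \<chi>'_eq[OF Comp_in_hom[OF f h(1)]] \<gamma>.source.Comp_assoc[OF f h(1) g0]
          \<gamma>.arr_map_Comp[OF f h(1)] h(2) by simp
      show "\<exists>g\<in>hom C b e. \<forall>f1\<in>hom C a b. \<forall>f2\<in>hom C a b.
        arr_map (\<delta> \<circ>\<^sub>F \<gamma>) f1 = arr_map (\<delta> \<circ>\<^sub>F \<gamma>) f2 \<longrightarrow> \<chi> (Comp C g f1) = \<chi> (Comp C g f2)"
      proof (intro bexI[OF _ Comp_in_hom[OF h(1) g0]] ballI impI)
        fix f1 f2
        assume f: "f1 \<in> hom C a b" "f2 \<in> hom C a b"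
          and "arr_map (\<delta> \<circ>\<^sub>F \<gamma>) f1 = arr_map (\<delta> \<circ>\<^sub>F \<gamma>) f2"
        \<comment> \<open>The assumption on \<open>f1\<close> and \<open>f2\<close> says that
          \<open>\<delta>\<close> identifies their images under \<open>\<gamma>\<close>.\<close>
        then have "\<chi>' (Comp D g' (arr_map \<gamma> f1)) = \<chi>' (Comp D g' (arr_map \<gamma> f2))"
          by (intro g'_eq \<gamma>.arr_map_in_hom) (simp_all add: funct_comp_def)
        then show "\<chi> (Comp C (Comp C g0 h) f1) = \<chi> (Comp C (Comp C g0 h) f2)"
          using f by (simp add: \<chi>_lift)
      qed
    qed
  qed
qed

end
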